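(* Let $(\overline{\mathfrak{p}};\overline{\mathfrak{q}})_{n}=(\mathfrak{p}_{1},\ldots,\mathfrak{p}_{n};\mathfrak{q}_{1},\ldots,\mathfrak{q}_{n})\in \mathcal{LMQB}_{n}$ and $(\overline{\mathfrak{l}};\overline{\mathfrak{s}})_{m}=(\mathfrak{l}_{1},\ldots,\mathfrak{l}_{m};\mathfrak{s}_{1},\ldots,\mathfrak{s}_{m})\in \mathcal{LMQB}_{m}$. For $k=2,\ldots,n$ let $(\overline{\mathfrak{p}};\overline{\mathfrak{q}})_{n}\bullet_{k}(\overline{\mathfrak{l}};\overline{\mathfrak{s}})_{m}$ be the bi-vector whose first component is $$(\mathfrak{p}_{1},\ldots,\mathfrak{p}_{k-2},\ \mathfrak{p}_{k-1}+I,\ \mathfrak{l}_{2}-\mathfrak{s}_{2},\ \mathfrak{l}_{3},\ldots,\mathfrak{l}_{m},\ (\mathfrak{p}_{k}-\mathfrak{q}_{k})-\mathfrak{q}_{k}\mathfrak{l}_{1},\ \mathfrak{p}_{k+1},\ldots,\mathfrak{p}_{n})$$ and whose second component is $$(\mathfrak{q}_{1},\ldots,\mathfrak{q}_{k-1},\ \mathfrak{s}_{2},\ldots,\mathfrak{s}_{m},\ -\mathfrak{q}_{k}\mathfrak{s}_{1},\ \mathfrak{q}_{k+1},\ldots,\mathfrak{q}_{n}),$$ and let $$(\overline{\mathfrak{p}};\overline{\mathfrak{q}})_{n}\bullet_{1}(\overline{\mathfrak{l}};\overline{\mathfrak{s}})_{m}=((\mathfrak{p}_{1}-\mathfrak{q}_{1})-\mathfrak{q}_{1}\mathfrak{l}_{1},\mathfrak{p}_{2},\ldots,\mathfrak{p}_{n-1},\mathfrak{p}_{n}+I,\mathfrak{l}_{2}-\mathfrak{s}_{2},\mathfrak{l}_{3},\ldots,\mathfrak{l}_{m};\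 -\mathfrak{q}_{1}\mathfrak{s}_{1},\mathfrak{q}_{2},\ldots,\mathfrak{q}_{n},\mathfrak{s}_{2},\ldots,\mathfrak{s}_{m}).$$ Then $(\overline{\mathfrak{p}};\overline{\mathfrak{q}})_{n}\bullet_{k}(\overline{\mathfrak{l}};\overline{\mathfrak{s}})_{m}\in \mathcal{LMQB}_{n+m-1}$ for $k=1,\ldots,n$.
   Context: Fix $l\ge 1$; all entries are $l\times l$ matrices (real or complex), $I$ and $O$ are the $l\times l$ identity and zero matrices. A bi-vector $(\mathfrak{p}_{1},\ldots,\mathfrak{p}_{n};\mathfrak{q}_{1},\ldots,\mathfrak{q}_{n})$ of $l\times l$ matrices is called a left matrix quiddity bi-sequence of length $n$ if $$\begin{pmatrix} \mathfrak{p}_{n} & \mathfrak{q}_{n}\\ I & O\end{pmatrix}\cdots\begin{pmatrix} \mathfrak{p}_{1} & \mathfrak{q}_{1}\\ I & O\end{pmatrix}=-\begin{pmatrix} I & O\\ O & I\end{pmatrix}.$$ $\mathcal{LMQB}_{n}$ is the set of all left matrix quiddity bi-sequences of length $n$. *)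

theory Defs
  imports Complex_Main "Jordan_Normal_Form.Matrix"
begin

text \<open>
  A bi-vector \<open>(p\<^sub>1,\<dots>,p\<^sub>n; q\<^sub>1,\<dots>,q\<^sub>n)\<close> is a pair of lists of matrices. Lists are accessed with
  indices starting at 1: \<open>entry xs i\<close> is \<open>x\<^sub>i\<close>, and \<open>slice xs i j\<close> is \<open>x\<^sub>i,\<dots>,x\<^sub>j\<close>, which is
  empty if \<open>j < i\<close>.

  The entries of the matrices are taken from the class of real normed fields, which has the real
  and the complex numbers as instances (and, by the theorem of Gelfand and Mazur, no others up to
  isomorphism).
\<close>

type_synonym 'a bivector = "'a mat list \<times> 'a mat list"

definition entry :: "'b list \<Rightarrow> nat \<Rightarrow> 'b" where
  "entry xs i = xs ! (i - 1)"

definition slice :: "'b list \<Rightarrow> nat \<Rightarrow> nat \<Rightarrow> 'b list" where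
  "slice xs i j = map (entry xs) [i..<j + 1]"

definition quiddity_mat :: "nat \<Rightarrow> 'a::real_normed_field mat \<Rightarrow> 'a mat \<Rightarrow> 'a mat" where
  "quiddity_mat l p q = four_block_mat p q (1\<^sub>m l) (0\<^sub>m l l)"

text \<open>Later factors are multiplied on the left: the value is \<open>M\<^sub>n * \<dots> * M\<^sub>1\<close>.\<close>

definition quiddity_prod :: "nat \<Rightarrow> 'a::real_normed_field bivector \<Rightarrow> 'a mat" where
  "quiddity_prod l = (\<lambda>(ps, qs).
     fold (\<lambda>M A. M * A) (map2 (quiddity_mat l) ps qs) (1\<^sub>m (l + l)))"

definition LMQB :: "nat \<Rightarrow> nat \<Rightarrow> 'a::real_normed_field bivector set" where
  "LMQB l n = {(ps, qs).
     length ps = n \<and> length qs = n \<and>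
     set ps \<subseteq> carrier_mat l l \<and> set qs \<subseteq> carrier_mat l l \<and>
     quiddity_prod l (ps, qs) = - four_block_mat (1\<^sub>m l) (0\<^sub>m l l) (0\<^sub>m l l) (1\<^sub>m l)}"

text \<open>
  The formulas below presuppose that both lengths are at least 2. For \<open>l \<ge> 1\<close> this holds for all
  members of \<open>LMQB l n\<close>, because \<open>LMQB l 0\<close> and \<open>LMQB l 1\<close> are empty.
\<close>

definition bullet ::
    "nat \<Rightarrow> nat \<Rightarrow> 'a::real_normed_field bivector \<Rightarrow> 'a bivector \<Rightarrow> 'a bivector" where
  "bullet l k = (\<lambda>(p, q) (r, s).
     let n = length p; m = length r in
     if k = 1 then
       ([(entry p 1 - entry q 1) - entry q 1 * entry r 1]
          @ slice p 2 (n - 1)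
          @ [entry p n + 1\<^sub>m l, entry r 2 - entry s 2]
          @ slice r 3 m,
        [- (entry q 1 * entry s 1)]
          @ slice q 2 n
          @ slice s 2 m)
     else
       (slice p 1 (k - 2)
          @ [entry p (k - 1) + 1\<^sub>m l, entry r 2 - entry s 2]
          @ slice r 3 m
          @ [(entry p k - entry q k) - entry q k * entry r 1]
          @ slice p (k + 1) n,
        slice q 1 (k - 1)
          @ slice s 2 m
          @ [- (entry q k * entry s 1)]
          @ slice q (k + 1) n))"

end

theory Submission imports Defs "Jordan_Normal_Form.Determinant" begin

text \<open>
  Write \<open>M(p, q)\<close> for the matrix with block rows \<open>(p, q)\<close> and \<open>(I, O)\<close>. There are constant
  invertible block matrices \<open>V\<close> and \<open>W = -V\<^sup>-\<^sup>1\<close> with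
  \<open>M(l\<^sub>2 - s\<^sub>2, s\<^sub>2) M(p + I, q) = M(l\<^sub>2, s\<^sub>2) V M(p, q)\<close> and
  \<open>M(p - q - q l\<^sub>1, -q s\<^sub>1) = M(p, q) W M(l\<^sub>1, s\<^sub>1)\<close>.
  For \<open>k \<ge> 2\<close> the inserted factors therefore contain \<open>W M(l\<^sub>1, s\<^sub>1) M(l\<^sub>m, s\<^sub>m) \<dots> M(l\<^sub>2, s\<^sub>2) V\<close>. Since
  one-sided inverses of square matrices are two-sided, the inner product is \<open>-I\<close> as well, so this is
  \<open>-W V = I\<close> and what remains is the product of the first bi-sequence. For \<open>k = 1\<close> the same
  cancellation happens with the roles of the two bi-sequences exchanged.
\<close>

section \<open>Lists and the explicit form of the composition\<close>

lemma slice_eq_take_drop: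
  assumes "1 \<le> i" and "j \<le> length xs"
  shows "slice xs i j = take (j + 1 - i) (drop (i - 1) xs)"
proof (rule nth_equalityI)
  show "length (slice xs i j) = length (take (j + 1 - i) (drop (i - 1) xs))"
    using assms by (auto simp: slice_def)
next
  fix t assume "t < length (slice xs i j)"
  then have "t < j + 1 - i" by (simp add: slice_def del: upt_Suc)
  then show "slice xs i j ! t = take (j + 1 - i) (drop (i - 1) xs) ! t"
    using assms by (simp add: slice_def entry_def add.commute del: upt_Suc)
qed

lemma list_split_at_pair:
  assumes "i + 2 \<le> length xs"
  obtains us a b vs where "xs = us @ a # b # vs" and "length us = i"
proof
  show "xs = take i xs @ xs ! i # xs ! (i + 1) # drop (i + 2) xs"
    using assms by (simp add: Cons_nth_drop_Suc)
  show "length (take i xs) = i" using assms by simp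
qed

lemma list_two_ends:
  assumes "2 \<le> length xs"
  obtains a us b where "xs = a # us @ [b]"
proof -
  from assms obtain a ys where "xs = a # ys" and "ys \<noteq> []"
    by (cases xs) fastforce+
  then show thesis using that[of a "butlast ys" "last ys"] by simp
qed

text \<open>For \<open>k = 1\<close> the changed entries of the first bi-sequence are its last,
  \<open>a\<close> and \<open>c\<close>, and its first, \<open>b\<close> and \<open>d\<close>: these
  are cyclic neighbours, so the inserted entries go to the end.\<close>

lemma bullet_first:
  assumes "length q1 = length p1" and "length s' = length r'"
  shows "bullet l 1 (b # p1 @ [a], d # q1 @ [c]) (x # y # r', z # w # s') =
    ((b - d - d * x) # p1 @ [a + 1\<^sub>m l, y - w] @ r', - (d * z) # q1 @ [c] @ [w] @ s')"
  using assms by (simp add: bullet_def slice_eq_take_drop entry_def)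

text \<open>Here \<open>a\<close> and \<open>b\<close> are the entries with numbers
  \<open>k - 1\<close> and \<open>k\<close>, hence \<open>k = length p1 + 2\<close>. The letters
  match those of the case \<open>k = 1\<close>, so both cases use the same two matrix
  identities.\<close>

lemma bullet_later:
  assumes "length q1 = length p1" and "length q2 = length p2" and "length s' = length r'"
  shows "bullet l (length p1 + 2) (p1 @ a # b # p2, q1 @ c # d # q2) (x # y # r', z # w # s') =
    (p1 @ [a + 1\<^sub>m l, y - w] @ r' @ [b - d - d * x] @ p2,
     q1 @ [c, w] @ s' @ [- (d * z)] @ q2)"
  using assms by (simp add: bullet_def slice_eq_take_drop entry_def nth_append)

section \<open>Products of quiddity matrices\<close>

lemma quiddity_mat_carrier [simp]:
  assumes "p \<in> carrier_mat l l"
  shows "quiddity_mat l p q \<in> carrier_mat (l + l) (l + l)"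
  using assms by (simp add: quiddity_mat_def)

text \<open>With a single dimension \<open>N\<close>, later fixed to \<open>l + l\<close>, the
  simplifier has no dimensions left to guess when it reassociates.\<close>

lemma mult_assoc_square:
  assumes "A \<in> carrier_mat N N" and "B \<in> carrier_mat N N" and "C \<in> carrier_mat N N"
  shows "(A * B) * C = A * (B * C)"
  using assms by (rule assoc_mult_mat)

lemma quiddity_prod_Nil [simp]: "quiddity_prod l ([], []) = 1\<^sub>m (l + l)"
  by (simp add: quiddity_prod_def)

text \<open>The induction is from the right because the last factor is outermost in the product. The
  carrier claim is carried along since associativity in the step depends on it.\<close>

lemma fold_left_mult_mat:
  fixes A :: "'a::semiring_1 mat"
  assumes "set Ms \<subseteq> carrier_mat N N" and "A \<in> carrier_mat N N"
  shows "fold (\<lambda>M A. M * A) Ms (1\<^sub>m N) \<in> carrier_mat N N \<and>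
    fold (\<lambda>M A. M * A) Ms A = fold (\<lambda>M A. M * A) Ms (1\<^sub>m N) * A"
  using assms
proof (induction Ms rule: rev_induct)
  case Nil
  then show ?case by simp
next
  case (snoc M Ms)
  then show ?case by (auto simp: mult_assoc_square)
qed

lemma set_map2_quiddity_mat:
  assumes "set ps \<subseteq> carrier_mat l l"
  shows "set (map2 (quiddity_mat l) ps qs) \<subseteq> carrier_mat (l + l) (l + l)"
  using assms by (auto dest!: set_zip_leftD)

lemma quiddity_prod_carrier [simp]:
  assumes "set ps \<subseteq> carrier_mat l l"
  shows "quiddity_prod l (ps, qs) \<in> carrier_mat (l + l) (l + l)"
  using fold_left_mult_mat[OF set_map2_quiddity_mat[OF assms] one_carrier_mat]
  by (simp add: quiddity_prod_def)

lemma quiddity_prod_append: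
  assumes "length ps = length qs" and "set ps \<subseteq> carrier_mat l l" and "set ps' \<subseteq> carrier_mat l l"
  shows "quiddity_prod l (ps @ ps', qs @ qs') = quiddity_prod l (ps', qs') * quiddity_prod l (ps, qs)"
  using fold_left_mult_mat[OF set_map2_quiddity_mat[OF assms(3)] quiddity_prod_carrier[OF assms(2)]]
    assms(1)
  by (simp add: quiddity_prod_def)

lemma quiddity_prod_Cons:
  assumes "p \<in> carrier_mat l l" and "set ps \<subseteq> carrier_mat l l"
  shows "quiddity_prod l (p # ps, q # qs) = quiddity_prod l (ps, qs) * quiddity_mat l p q"
proof -
  have "quiddity_prod l ([p], [q]) = quiddity_mat l p q"
    using assms by (simp add: quiddity_prod_def right_mult_one_mat[OF quiddity_mat_carrier])
  then show ?thesis
    using quiddity_prod_append[of "[p]" "[q]" l ps qs] assms by simp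
qed

section \<open>Block computations with \<open>V\<close> and \<open>W\<close>\<close>

lemma mult_four_block_square:
  fixes A B C D E F G H :: "'a::semiring_0 mat"
  assumes "A \<in> carrier_mat l l" "B \<in> carrier_mat l l" "C \<in> carrier_mat l l" "D \<in> carrier_mat l l"
    and "E \<in> carrier_mat l l" "F \<in> carrier_mat l l" "G \<in> carrier_mat l l" "H \<in> carrier_mat l l"
  shows "four_block_mat A B C D * four_block_mat E F G H =
    four_block_mat (A * E + B * G) (A * F + B * H) (C * E + D * G) (C * F + D * H)"
  using assms by (rule mult_four_block_mat)

lemma four_block_one: "four_block_mat (1\<^sub>m l) (0\<^sub>m l l) (0\<^sub>m l l) (1\<^sub>m l) = 1\<^sub>m (l + l)"
  by (rule eq_matI) auto

text \<open>\<open>V\<close> and \<open>W\<close> of the introduction.\<close>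

definition insert_mat :: "nat \<Rightarrow> 'a::real_normed_field mat" where
  "insert_mat l = four_block_mat (1\<^sub>m l) (1\<^sub>m l) (- 1\<^sub>m l) (0\<^sub>m l l)"

definition cancel_mat :: "nat \<Rightarrow> 'a::real_normed_field mat" where
  "cancel_mat l = four_block_mat (0\<^sub>m l l) (1\<^sub>m l) (- 1\<^sub>m l) (- 1\<^sub>m l)"

lemma insert_cancel_carrier [simp]:
  "insert_mat l \<in> carrier_mat (l + l) (l + l)"
  "cancel_mat l \<in> carrier_mat (l + l) (l + l)"
  by (simp_all add: insert_mat_def cancel_mat_def)

lemma four_block_uminus_one:
  "four_block_mat (- 1\<^sub>m l) (0\<^sub>m l l) (0\<^sub>m l l) (- 1\<^sub>m l) = (- 1\<^sub>m (l + l) :: 'a::ring_1 mat)"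
  by (rule eq_matI) auto

lemma uminus_zero_mat: "- 0\<^sub>m nr nc = (0\<^sub>m nr nc :: 'a::group_add mat)"
  by (rule eq_matI) auto

lemma uminus_mult_square:
  fixes A B :: "'a::ring mat"
  assumes "A \<in> carrier_mat N N" and "B \<in> carrier_mat N N"
  shows "- A * B = - (A * B)" and "A * - B = - (A * B)"
  using assms by auto

lemma cancel_mult_insert: "cancel_mat l * insert_mat l = - 1\<^sub>m (l + l)"
proof -
  have "cancel_mat l * insert_mat l =
      four_block_mat (- 1\<^sub>m l) (0\<^sub>m l l) (0\<^sub>m l l) (- 1\<^sub>m l :: 'a mat)"
    unfolding cancel_mat_def insert_mat_def
    by (subst mult_four_block_square[of _ l])
       (auto intro!: arg_cong4[where f = four_block_mat] eq_matI)
  then show ?thesis by (simp only: four_block_uminus_one)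
qed

text \<open>Serves twice: to get \<open>V W = -I\<close> from \<open>W V = -I\<close>, and to rotate
  the product of the second bi-sequence cyclically.\<close>

lemma mult_eq_uminus_one_commute:
  fixes A B :: "'a::field mat"
  assumes "A \<in> carrier_mat N N" and "B \<in> carrier_mat N N" and "A * B = - 1\<^sub>m N"
  shows "B * A = - 1\<^sub>m N"
proof -
  \<comment> \<open>Moving the sign onto \<open>A\<close> turns \<open>B\<close> into a right
    inverse, which for square matrices is two-sided.\<close>
  have "- A * B = 1\<^sub>m N" using assms by simp
  then have "B * - A = 1\<^sub>m N" using assms by (intro mat_mult_left_right_inverse[of "- A"]) auto
  then have "- (B * A) = 1\<^sub>m N" using assms by simp
  then show ?thesis by (metis uminus_uminus_mat)
qed

text \<open>\<open>V\<close> collects two shears: \<open>M(y - w, w)\<close> is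
  \<open>M(y, w)\<close> times the block matrix with rows \<open>(I, O)\<close>,
  \<open>(-I, I)\<close>, and \<open>M(a + I, c)\<close> is the one with rows \<open>(I, I)\<close>,
  \<open>(O, I)\<close> times \<open>M(a, c)\<close>. The product of the shears is
  \<open>V\<close>.\<close>

lemma quiddity_mat_insert:
  assumes "a \<in> carrier_mat l l" "c \<in> carrier_mat l l" "y \<in> carrier_mat l l" "w \<in> carrier_mat l l"
  shows "quiddity_mat l (y - w) w * quiddity_mat l (a + 1\<^sub>m l) c =
    quiddity_mat l y w * (insert_mat l * quiddity_mat l a c)"
proof -
  have "insert_mat l * quiddity_mat l a c = four_block_mat (a + 1\<^sub>m l) c (- a) (- c)"
    unfolding insert_mat_def quiddity_mat_def
    using assms by (subst mult_four_block_square[of _ l]) auto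
  moreover have "y * (a + 1\<^sub>m l) + w * (- a) = (y - w) * (a + 1\<^sub>m l) + w * 1\<^sub>m l"
  proof -
    have "y * (a + 1\<^sub>m l) = y * a + y"
      using assms by (subst mult_add_distrib_mat[of _ l l]) auto
    moreover have "(y - w) * (a + 1\<^sub>m l) = (y * a - w * a) + (y - w)"
      using assms by (subst mult_add_distrib_mat[of _ l l]) (auto simp: minus_mult_distrib_mat)
    ultimately show ?thesis
      using assms by (auto intro!: eq_matI)
  qed
  moreover have "y * c + w * (- c) = (y - w) * c"
    using assms
    by (simp add: minus_mult_distrib_mat[of y l l w c l] minus_add_uminus_mat[of "y * c" l l])
  ultimately show ?thesis
    unfolding quiddity_mat_def using assms
    by (simp add: mult_four_block_square[of _ l] minus_carrier_mat uminus_zero_mat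
        mult_carrier_mat[of _ l l] right_add_zero_mat[of _ l l])
qed

text \<open>The upper block row of \<open>W M(x, z)\<close> is \<open>(I, O)\<close>, so multiplying
  by \<open>M(b, d)\<close> on the left again gives the lower row \<open>(I, O)\<close> of a
  quiddity matrix.\<close>

lemma quiddity_mat_cancel:
  assumes "b \<in> carrier_mat l l" "d \<in> carrier_mat l l" "x \<in> carrier_mat l l" "z \<in> carrier_mat l l"
  shows "quiddity_mat l (b - d - d * x) (- (d * z)) =
    quiddity_mat l b d * (cancel_mat l * quiddity_mat l x z)"
proof -
  have "cancel_mat l * quiddity_mat l x z =
      four_block_mat (1\<^sub>m l) (0\<^sub>m l l) (- x - 1\<^sub>m l) (- z)"
    unfolding cancel_mat_def quiddity_mat_def
    using assms by (subst mult_four_block_square[of _ l])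
       (auto intro!: arg_cong4[where f = four_block_mat] eq_matI)
  moreover have "b * 1\<^sub>m l + d * (- x - 1\<^sub>m l) = b - d - d * x"
    using assms by (subst mult_minus_distrib_mat[of _ l l]) (auto intro!: eq_matI)
  ultimately show ?thesis
    unfolding quiddity_mat_def using assms
    by (simp add: mult_four_block_square[of _ l] minus_carrier_mat uminus_zero_mat)
qed

section \<open>Membership in \<open>LMQB\<close> and its preservation by the composition\<close>

lemma LMQB_iff:
  "(ps, qs) \<in> LMQB l n \<longleftrightarrow>
    length ps = n \<and> length qs = n \<and> set ps \<subseteq> carrier_mat l l \<and> set qs \<subseteq> carrier_mat l l \<and>
    quiddity_prod l (ps, qs) = - 1\<^sub>m (l + l)"
  by (simp add: LMQB_def four_block_one)

text \<open>The empty product is \<open>I\<close>, which differs from \<open>-I\<close> in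
  characteristic zero; a single factor has \<open>I\<close> as its lower left block, where
  \<open>-I\<close> has \<open>O\<close>.\<close>

lemma LMQB_length_ge_2:
  fixes ps qs :: "'a::real_normed_field mat list"
  assumes "(ps, qs) \<in> LMQB l n" and "1 \<le> l"
  shows "2 \<le> n"
proof (rule ccontr)
  assume "\<not> 2 \<le> n"
  then consider "n = 0" | "n = 1" by linarith
  then show False
  proof cases
    case 1
    have "ps = []" "qs = []" using assms(1) 1 by (auto simp: LMQB_iff)
    then have "(1\<^sub>m (l + l) :: 'a mat) $$ (0, 0) = (- 1\<^sub>m (l + l)) $$ (0, 0)"
      using assms(1) by (simp add: LMQB_iff)
    then show False using assms(2) by simp
  next
    case 2
    with assms obtain p q where pq: "ps = [p]" "qs = [q]" "p \<in> carrier_mat l l"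
      and "quiddity_prod l ([p], [q]) = - 1\<^sub>m (l + l)"
      by (auto simp: LMQB_iff length_Suc_conv)
    then have "quiddity_mat l p q = - 1\<^sub>m (l + l)"
      by (simp add: quiddity_prod_Cons left_mult_one_mat[OF quiddity_mat_carrier])
    \<comment> \<open>Indices start at 0, so \<open>(l, 0)\<close> is the corner of the lower left
      block; it exists by \<open>1 \<le> l\<close>.\<close>
    then have "quiddity_mat l p q $$ (l, 0) = (- 1\<^sub>m (l + l)) $$ (l, 0)" by simp
    then show False using assms(2) pq(3) by (simp add: quiddity_mat_def)
  qed
qed

text \<open>The product regroups as \<open>R M(y, w) V (M(a, c) P M(b, d)) W M(x, z)\<close>. The
  bracket is the whole product of the first bi-sequence, so \<open>-V W = I\<close> leaves the
  product of the second.\<close>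

lemma bullet_first_in_LMQB:
  assumes "(b # p1 @ [a], d # q1 @ [c]) \<in> LMQB l n"
    and "(x # y # r', z # w # s') \<in> LMQB l m"
  shows "bullet l 1 (b # p1 @ [a], d # q1 @ [c]) (x # y # r', z # w # s') \<in> LMQB l (n + m - 1)"
proof -
  note [simp] = quiddity_prod_Cons quiddity_prod_append mult_assoc_square[where N = "l + l"]
    mult_carrier_mat[of _ "l + l" "l + l"]
  define R where "R = quiddity_prod l (r', s')"
  define P where "P = quiddity_prod l (p1, q1)"
  have len: "length q1 = length p1" "length s' = length r'"
    and c [simp]: "a \<in> carrier_mat l l" "b \<in> carrier_mat l l" "c \<in> carrier_mat l l"
      "d \<in> carrier_mat l l" "x \<in> carrier_mat l l" "y \<in> carrier_mat l l" "z \<in> carrier_mat l l"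
      "w \<in> carrier_mat l l" "set p1 \<subseteq> carrier_mat l l" "set q1 \<subseteq> carrier_mat l l"
      "set r' \<subseteq> carrier_mat l l" "set s' \<subseteq> carrier_mat l l"
    and n: "n = length p1 + 2" and m: "m = length r' + 2"
    using assms by (auto simp: LMQB_iff)
  have RP [simp]: "R \<in> carrier_mat (l + l) (l + l)" "P \<in> carrier_mat (l + l) (l + l)"
    by (simp_all add: R_def P_def)
  have [simp]: "b - d - d * x \<in> carrier_mat l l" "a + 1\<^sub>m l \<in> carrier_mat l l"
      "y - w \<in> carrier_mat l l" "d * z \<in> carrier_mat l l"
    using c by (simp_all add: minus_carrier_mat mult_carrier_mat[of _ l l])
  let ?M = "quiddity_mat l" and ?V = "insert_mat l" and ?W = "cancel_mat l"
  have prod_p: "?M a c * (P * ?M b d) = - 1\<^sub>m (l + l)"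
    using assms(1) len
    by (simp add: LMQB_iff P_def left_mult_one_mat[of _ "l + l" "l + l"])
  have prod_r: "R * (?M y w * ?M x z) = - 1\<^sub>m (l + l)"
    using assms(2) by (simp add: LMQB_iff R_def)
  have VW: "?V * ?W = - 1\<^sub>m (l + l)"
    by (rule mult_eq_uminus_one_commute[OF _ _ cancel_mult_insert]) simp_all
  have "quiddity_prod l ((b - d - d * x) # p1 @ [a + 1\<^sub>m l, y - w] @ r',
      - (d * z) # q1 @ [c] @ [w] @ s') =
      R * ((?M (y - w) w * ?M (a + 1\<^sub>m l) c) * (P * ?M (b - d - d * x) (- (d * z))))"
    using len by (simp add: R_def P_def)
  also have "\<dots> = R * (?M y w * (?V * ((?M a c * (P * ?M b d)) * (?W * ?M x z))))"
    unfolding quiddity_mat_insert[OF c(1,3,6,8)] quiddity_mat_cancel[OF c(2,4,5,7)]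
    by simp
  also have "\<dots> = R * (?M y w * (- (?V * ?W) * ?M x z))"
    unfolding prod_p by (simp add: left_mult_one_mat[of _ "l + l" "l + l"] uminus_mult_square[where N = "l + l"])
  also have "\<dots> = - 1\<^sub>m (l + l)"
    unfolding VW using prod_r by (simp add: left_mult_one_mat[of _ "l + l" "l + l"])
  finally show ?thesis
    using len n m by (simp only: bullet_first) (auto simp: LMQB_iff)
qed

text \<open>The product regroups as \<open>Q M(b, d) W (M(x, z) R M(y, w)) V M(a, c) P\<close>. The
  bracket is a cyclic rotation of the second product, so \<open>-W V = I\<close> leaves the
  first.\<close>

lemma bullet_later_in_LMQB:
  assumes "(p1 @ a # b # p2, q1 @ c # d # q2) \<in> LMQB l n" and "length q1 = length p1"
    and "(x # y # r', z # w # s') \<in> LMQB l m"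
  shows "bullet l (length p1 + 2) (p1 @ a # b # p2, q1 @ c # d # q2) (x # y # r', z # w # s')
    \<in> LMQB l (n + m - 1)"
proof -
  note [simp] = quiddity_prod_Cons quiddity_prod_append mult_assoc_square[where N = "l + l"]
    mult_carrier_mat[of _ "l + l" "l + l"]
  define R where "R = quiddity_prod l (r', s')"
  define P where "P = quiddity_prod l (p1, q1)"
  define Q where "Q = quiddity_prod l (p2, q2)"
  have len: "length q1 = length p1" "length q2 = length p2" "length s' = length r'"
    and c [simp]: "a \<in> carrier_mat l l" "b \<in> carrier_mat l l" "c \<in> carrier_mat l l"
      "d \<in> carrier_mat l l" "x \<in> carrier_mat l l" "y \<in> carrier_mat l l" "z \<in> carrier_mat l l"
      "w \<in> carrier_mat l l" "set p1 \<subseteq> carrier_mat l l" "set q1 \<subseteq> carrier_mat l l"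
      "set p2 \<subseteq> carrier_mat l l" "set q2 \<subseteq> carrier_mat l l"
      "set r' \<subseteq> carrier_mat l l" "set s' \<subseteq> carrier_mat l l"
    and n: "n = length p1 + length p2 + 2" and m: "m = length r' + 2"
    using assms by (auto simp: LMQB_iff)
  have RPQ [simp]: "R \<in> carrier_mat (l + l) (l + l)" "P \<in> carrier_mat (l + l) (l + l)"
      "Q \<in> carrier_mat (l + l) (l + l)"
    by (simp_all add: R_def P_def Q_def)
  have [simp]: "b - d - d * x \<in> carrier_mat l l" "a + 1\<^sub>m l \<in> carrier_mat l l"
      "y - w \<in> carrier_mat l l" "d * z \<in> carrier_mat l l"
    using c by (simp_all add: minus_carrier_mat mult_carrier_mat[of _ l l])
  let ?M = "quiddity_mat l" and ?V = "insert_mat l" and ?W = "cancel_mat l"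
  have prod_p: "Q * (?M b d * (?M a c * P)) = - 1\<^sub>m (l + l)"
    using assms(1) len by (simp add: LMQB_iff P_def Q_def)
  have "R * (?M y w * ?M x z) = - 1\<^sub>m (l + l)"
    using assms(3) by (simp add: LMQB_iff R_def)
  \<comment> \<open>The first factor \<open>M(x, z)\<close> moves from the right end of the product
    to the left end.\<close>
  then have prod_r: "?M x z * (R * ?M y w) = - 1\<^sub>m (l + l)"
    by (intro mult_eq_uminus_one_commute[of "R * ?M y w"]) simp_all
  have "quiddity_prod l (p1 @ [a + 1\<^sub>m l, y - w] @ r' @ [b - d - d * x] @ p2,
      q1 @ [c, w] @ s' @ [- (d * z)] @ q2) =
      Q * (?M (b - d - d * x) (- (d * z)) * (R * ((?M (y - w) w * ?M (a + 1\<^sub>m l) c) * P)))"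
    using len by (simp add: R_def P_def Q_def)
  also have "\<dots> = Q * (?M b d * (?W * ((?M x z * (R * ?M y w)) * (?V * (?M a c * P)))))"
    unfolding quiddity_mat_insert[OF c(1,3,6,8)] quiddity_mat_cancel[OF c(2,4,5,7)]
    by simp
  also have "\<dots> = Q * (?M b d * (- (?W * ?V) * (?M a c * P)))"
    unfolding prod_r by (simp add: left_mult_one_mat[of _ "l + l" "l + l"] uminus_mult_square[where N = "l + l"])
  also have "\<dots> = - 1\<^sub>m (l + l)"
    unfolding cancel_mult_insert
    using prod_p by (simp add: left_mult_one_mat[of _ "l + l" "l + l"])
  finally show ?thesis
    using len n m by (simp only: bullet_later) (auto simp: LMQB_iff)
qed

theorem theorem33:
  fixes l n m k :: nat
    and p q r s :: "'a::real_normed_field mat list"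
  assumes "1 \<le> l"
    and "(p, q) \<in> LMQB l n"
    and "(r, s) \<in> LMQB l m"
    and "1 \<le> k" and "k \<le> n"
  shows "bullet l k (p, q) (r, s) \<in> LMQB l (n + m - 1)"
proof -
  have n: "2 \<le> n" "length p = n" "length q = n" and m: "2 \<le> m" "length r = m" "length s = m"
    using assms LMQB_length_ge_2 by (auto simp: LMQB_iff)
  obtain x y r' where r: "r = x # y # r'"
    using m by (metis Suc_le_length_iff numeral_2_eq_2)
  obtain z w s' where s: "s = z # w # s'"
    using m by (metis Suc_le_length_iff numeral_2_eq_2)
  show ?thesis
  proof (cases "k = 1")
    case True
    obtain b p1 a where p: "p = b # p1 @ [a]" using n list_two_ends by metis
    obtain d q1 c where q: "q = d # q1 @ [c]" using n list_two_ends by metis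
    show ?thesis using assms(2,3) bullet_first_in_LMQB unfolding p q r s True by blast
  next
    case False
    then have k: "2 \<le> k" using assms(4) by simp
    \<comment> \<open>Both lists are cut after \<open>k - 2\<close> entries, so the exposed pair has
      numbers \<open>k - 1\<close> and \<open>k\<close>.\<close>
    with n assms(5) have "(k - 2) + 2 \<le> length p" "(k - 2) + 2 \<le> length q" by simp_all
    then obtain p1 a b p2 q1 c d q2
      where p: "p = p1 @ a # b # p2" "length p1 = k - 2"
        and q: "q = q1 @ c # d # q2" "length q1 = k - 2"
      by (metis list_split_at_pair)
    then have "k = length p1 + 2" "length q1 = length p1" using k by simp_all
    then show ?thesis using assms(2,3) bullet_later_in_LMQB unfolding p(1) q(1) r s by blast
  qed
qed

end
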